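(* For all positive integers $n$ and $b$ there exists a transmission array $\mathcal T$ for $n$ stations and $b$ channels, of length $\mathcal O(n\log n\log^{1/b} n)$, such that the algorithm Wake-Up$(\mathcal T)$ wakes up the network within $\mathcal O(k\log n\log^{1/b}k)$ time steps (counted from the first spontaneous activation), for every $k\le n$ and every activation pattern in which at most $k$ stations are activated spontaneously. The constants in the $\mathcal O$-notation are absolute.
   Context: Model: $n$ stations with distinct names in $\{1,\dots,n\}$ and $b$ channels numbered $1,\dots,b$. Time is divided into synchronous global time steps. In each step each active station may transmit on any subset of channels; all stations listen on all channels. A message on channel $\beta$ in a step is heard by everybody iff exactly one station transmits on $\beta$ in that step; otherwise nothing is heard (no collision detection). Initially all stations are passive; an activation pattern specifies at most $k$ stations and arbitrary time steps $\sigma_u$ at which each such station $u$ becomes active spontaneously. An active station $u$ perceives global time step $t$ as its local round $t-\sigma_u$. The network is woken up at the first time step at which some channel carries a transmission by exactly one station. A transmission array of length $\ell$ is an array of bits $T(u,\beta,j)$ for stations $u$, channels $\beta$ and positions $1\le j\le\ell$. Algorithm Wake-Up$(\mathcal T)$: each activated station $u$, in its local round $j\le\ell$, transmits on channel $\beta$ iff $T(u,\beta,j)=1$, and stops once a message has been heard. The array depends only on $n$ and $b$; $k$ is unknown to the stations. Logarithms are binary. *)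

theory Defs
  imports Complex_Main
begin

text \<open>Transmission array: T u beta j, station u in {1..n}, channel beta in {1..b},
  position j in {1..len}. Activation pattern: set S of spontaneously activated
  stations with activation times sigma u (global time steps are naturals).\<close>

type_synonym tarray = "nat \<Rightarrow> nat \<Rightarrow> nat \<Rightarrow> bool"

text \<open>Station u transmits on channel beta at global time step t under
  Wake-Up(T) with array length len, before the network is woken up
  (before any message is heard, only spontaneously activated stations are active).\<close>
definition transmits :: "tarray \<Rightarrow> nat \<Rightarrow> nat set \<Rightarrow> (nat \<Rightarrow> nat) \<Rightarrow> nat \<Rightarrow> nat \<Rightarrow> nat \<Rightarrow> bool" where
  "transmits T len S sigma u beta t \<longleftrightarrow>
     u \<in> S \<and> sigma u \<le> t \<and> 1 \<le> t - sigma u \<and> t - sigma u \<le> len \<and> T u beta (t - sigma u)"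

definition woken_at :: "nat \<Rightarrow> tarray \<Rightarrow> nat \<Rightarrow> nat set \<Rightarrow> (nat \<Rightarrow> nat) \<Rightarrow> nat \<Rightarrow> bool" where
  "woken_at b T len S sigma t \<longleftrightarrow>
     (\<exists>beta \<in> {1..b}. card {u \<in> S. transmits T len S sigma u beta t} = 1)"

definition first_activation :: "nat set \<Rightarrow> (nat \<Rightarrow> nat) \<Rightarrow> nat" where
  "first_activation S sigma = Min (sigma ` S)"

definition wakes_within :: "nat \<Rightarrow> tarray \<Rightarrow> nat \<Rightarrow> nat set \<Rightarrow> (nat \<Rightarrow> nat) \<Rightarrow> real \<Rightarrow> bool" where
  "wakes_within b T len S sigma m \<longleftrightarrow>
     (\<exists>t. first_activation S sigma \<le> t \<and>
          real (t - first_activation S sigma) \<le> m \<and> woken_at b T len S sigma t)"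

text \<open>Binary logarithm, floored at 1 so that O-bounds are meaningful for n = 1, k = 1.\<close>
definition lg :: "nat \<Rightarrow> real" where
  "lg x = max 1 (log 2 (real x))"

end

theory Submission
  imports Defs "HOL-Probability.Product_PMF"
begin

text \<open>The array is random. The local rounds are cut into levels \<open>l = 1, 2, \<dots>\<close>, level \<open>l\<close> ending at round
  about \<open>M 2\<^sup>l l\<^bsup>1/b\<^esup>\<close> with \<open>M\<close> of order \<open>log n\<close>, and a round of level \<open>l\<close> carries a one on
  channel \<open>\<beta>\<close> with probability \<open>2\<^bsup>-l\<^esup> (b l)\<^bsup>-\<beta>/b\<^esup>\<close>.

  For a given activation pattern let \<open>L\<close> be the least level such that at most \<open>2\<^sup>L\<close> stations are activated
  within \<open>bound L\<close> steps. In the second half of this window at least \<open>2\<^bsup>L-1\<^esup>\<close> stations are active, all of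
  level at most \<open>L\<close>. Let \<open>\<Psi> t \<beta>\<close> be the expected number of transmissions on channel \<open>\<beta>\<close> at step \<open>t\<close>.
  Then \<open>\<Psi> t 0 \<ge> 1/2\<close>, consecutive channels differ by a factor of at most \<open>(b L)\<^bsup>1/b\<^esup> \<le> 2 L\<^bsup>1/b\<^esup>\<close>, and the
  average of \<open>\<Psi> t b\<close> over the window is at most 4. So at a typical step some channel has
  \<open>\<Psi> t \<beta>\<close> between \<open>L\<^bsup>-1/b\<^esup>/4\<close> and 8, and carries exactly one transmission with probability of order
  \<open>L\<^bsup>-1/b\<^esup>\<close>. Different steps involve different bits, hence the network sleeps through the window
  with probability at most \<open>exp (- M 2\<^sup>L / 4\<^bsup>10\<^esup>)\<close>, which beats the number \<open>exp (O(2\<^sup>L log n))\<close> of patterns.\<close>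

section \<open>Independence of events in finite product distributions\<close>

definition depends_on :: "'a set \<Rightarrow> ('a \<Rightarrow> 'b) set \<Rightarrow> bool" where
  "depends_on A E \<longleftrightarrow> (\<forall>f g. (\<forall>x\<in>A. f x = g x) \<longrightarrow> (f \<in> E \<longleftrightarrow> g \<in> E))"

lemma depends_on_mono: "depends_on A E \<Longrightarrow> A \<subseteq> B \<Longrightarrow> depends_on B E"
  unfolding depends_on_def by (meson subset_eq)

lemma depends_on_cong: "depends_on A E \<Longrightarrow> (\<And>x. x \<in> A \<Longrightarrow> f x = g x) \<Longrightarrow> f \<in> E \<longleftrightarrow> g \<in> E"
  unfolding depends_on_def by blast

lemma depends_on_Int: "depends_on A E \<Longrightarrow> depends_on A F \<Longrightarrow> depends_on A (E \<inter> F)"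
  unfolding depends_on_def by (metis Int_iff)

text \<open>On a disjoint union \<open>Pi_pmf\<close> is the image of a pair of independent
  functions under the merging map \<open>?h\<close>, and the preimage of the intersection under
  \<open>?h\<close> is the rectangle of the two events. Events are sets of total functions, so the
  same event can be measured over different index sets.\<close>

lemma prob_Pi_pmf_Int_indep:
  assumes fin: "finite A" "finite B" and disj: "A \<inter> B = {}"
    and E: "depends_on A E" and F: "depends_on B F"
  shows "measure_pmf.prob (Pi_pmf (A \<union> B) d p) (E \<inter> F) =
         measure_pmf.prob (Pi_pmf A d p) E * measure_pmf.prob (Pi_pmf B d p) F"
proof -
  let ?PA = "Pi_pmf A d p" and ?PB = "Pi_pmf B d p"
  let ?h = "\<lambda>(f, g) x. if x \<in> A then f x else g x"
  have hE: "?h (f, g) \<in> E \<longleftrightarrow> f \<in> E" for f g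
    by (rule depends_on_cong[OF E]) auto
  have hF: "?h (f, g) \<in> F \<longleftrightarrow> g \<in> F" for f g
    by (rule depends_on_cong[OF F]) (use disj in auto)
  have vim: "?h -` (E \<inter> F) = E \<times> F"
    using hE hF by auto
  have "measure_pmf.prob (Pi_pmf (A \<union> B) d p) (E \<inter> F) =
        measure_pmf.prob (pair_pmf ?PA ?PB) (E \<times> F)"
    by (subst Pi_pmf_union[OF fin disj]) (simp only: measure_map_pmf vim)
  \<comment> \<open>The product rule is applied to countable sets, hence the restriction to the
    supports.\<close>
  also have "\<dots> = measure_pmf.prob (pair_pmf ?PA ?PB) ((E \<times> F) \<inter> set_pmf (pair_pmf ?PA ?PB))"
    by (simp only: measure_Int_set_pmf)
  also have "(E \<times> F) \<inter> set_pmf (pair_pmf ?PA ?PB) = (E \<inter> set_pmf ?PA) \<times> (F \<inter> set_pmf ?PB)"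
    by auto
  also have "measure_pmf.prob (pair_pmf ?PA ?PB) \<dots> =
      measure_pmf.prob ?PA (E \<inter> set_pmf ?PA) * measure_pmf.prob ?PB (F \<inter> set_pmf ?PB)"
    by (rule measure_pmf_prob_product) (auto intro: countable_subset[OF Int_lower2])
  finally show ?thesis
    by (simp only: measure_Int_set_pmf)
qed

text \<open>The coordinates outside \<open>A'\<close> form an independent factor, on which the event
  is the whole space.\<close>

lemma prob_Pi_pmf_subset:
  assumes "finite A" "A' \<subseteq> A" "depends_on A' E"
  shows "measure_pmf.prob (Pi_pmf A d p) E = measure_pmf.prob (Pi_pmf A' d p) E"
proof -
  have "measure_pmf.prob (Pi_pmf (A' \<union> (A - A')) d p) (E \<inter> UNIV) =
        measure_pmf.prob (Pi_pmf A' d p) E * measure_pmf.prob (Pi_pmf (A - A') d p) UNIV"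
    by (rule prob_Pi_pmf_Int_indep) (use assms in \<open>auto simp: depends_on_def dest: finite_subset\<close>)
  moreover have "A' \<union> (A - A') = A" using assms by auto
  ultimately show ?thesis by simp
qed

text \<open>Induction on \<open>W\<close>: the remaining events jointly depend on the union of their
  index sets, which is disjoint from \<open>I s\<close>.\<close>

lemma prob_Pi_pmf_INT_indep:
  assumes "finite W" "finite A" "\<And>t. t \<in> W \<Longrightarrow> I t \<subseteq> A" "disjoint_family_on I W"
    and "\<And>t. t \<in> W \<Longrightarrow> depends_on (I t) (E t)"
  shows "measure_pmf.prob (Pi_pmf A d p) (\<Inter>t\<in>W. E t) = (\<Prod>t\<in>W. measure_pmf.prob (Pi_pmf A d p) (E t))"
  using assms
proof (induction W rule: finite_induct)
  case (insert s W)
  let ?B = "\<Union>t\<in>W. I t" and ?F = "\<Inter>t\<in>W. E t"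
  have sub: "?B \<subseteq> A" "I s \<subseteq> A"
    using insert.prems by auto
  then have finB: "finite ?B" and finI: "finite (I s)"
    using insert.prems(1) finite_subset by blast+
  have disj: "I s \<inter> ?B = {}"
    using insert.prems(3) insert.hyps(2) by (fastforce simp: disjoint_family_on_def)
  have Es: "depends_on (I s) (E s)" using insert.prems by auto
  have F: "depends_on ?B ?F"
    unfolding depends_on_def
  proof (intro allI impI)
    fix f g :: "'b \<Rightarrow> 'c" assume eq: "\<forall>x\<in>?B. f x = g x"
    have "f \<in> E t \<longleftrightarrow> g \<in> E t" if "t \<in> W" for t
      by (rule depends_on_cong[OF insert.prems(4)[of t]]) (use eq that in auto)
    then show "f \<in> ?F \<longleftrightarrow> g \<in> ?F" by auto
  qed
  have EF: "depends_on (I s \<union> ?B) (E s \<inter> ?F)"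
    using depends_on_mono[OF Es, of "I s \<union> ?B"] depends_on_mono[OF F, of "I s \<union> ?B"]
    by (auto intro: depends_on_Int)
  have "measure_pmf.prob (Pi_pmf A d p) (\<Inter>t\<in>insert s W. E t) =
        measure_pmf.prob (Pi_pmf (I s \<union> ?B) d p) (E s \<inter> ?F)"
    using prob_Pi_pmf_subset[OF insert.prems(1) _ EF] sub by simp
  also have "\<dots> = measure_pmf.prob (Pi_pmf (I s) d p) (E s) * measure_pmf.prob (Pi_pmf ?B d p) ?F"
    by (rule prob_Pi_pmf_Int_indep[OF finI finB disj Es F])
  also have "\<dots> = measure_pmf.prob (Pi_pmf A d p) (E s) * measure_pmf.prob (Pi_pmf A d p) ?F"
    using prob_Pi_pmf_subset[OF insert.prems(1) sub(2) Es] prob_Pi_pmf_subset[OF insert.prems(1) sub(1) F]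
    by simp
  also have "measure_pmf.prob (Pi_pmf A d p) ?F = (\<Prod>t\<in>W. measure_pmf.prob (Pi_pmf A d p) (E t))"
    by (rule insert.IH) (use insert.prems in \<open>auto simp: disjoint_family_on_def\<close>)
  finally show ?case using insert.hyps by simp
qed simp

section \<open>Exactly one success among independent Bernoulli trials\<close>

text \<open>Both sides agree at p = 0 and p = 1/2, and the left one is convex.\<close>

lemma four_powr_minus_le:
  fixes p :: real
  assumes "0 \<le> p" "p \<le> 1/2"
  shows "4 powr (-p) \<le> 1 - p"
proof -
  have "4 powr (- p) = exp ((1 - 2*p) *\<^sub>R 0 + (2*p) *\<^sub>R (- ln 2))"
    using ln_realpow[of 2 2] by (simp add: powr_def)
  also have "\<dots> \<le> (1 - 2*p) * exp 0 + (2*p) * exp (- ln 2)"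
    using assms by (intro convex_onD[OF exp_convex]) auto
  also have "\<dots> = 1 - p" by (simp add: exp_minus)
  finally show ?thesis .
qed

text \<open>Summing over the unique success \<open>a\<close>: it contributes \<open>p a\<close>
  times the product of the other factors \<open>1 - p x\<close>, each at least
  \<open>4 powr (- p x)\<close>, so that product is at least \<open>4 powr (- s)\<close>.\<close>

lemma prob_exactly_one_ge:
  assumes "finite A" "I \<subseteq> A" and p: "\<And>a. a \<in> I \<Longrightarrow> 0 \<le> p a \<and> p a \<le> 1/2"
  defines "s \<equiv> sum p I"
  shows "measure_pmf.prob (Pi_pmf A False (\<lambda>a. bernoulli_pmf (p a))) {f. card {a\<in>I. f a} = 1}
         \<ge> s * 4 powr (- s)"
proof -
  let ?P = "measure_pmf.prob (Pi_pmf I False (\<lambda>a. bernoulli_pmf (p a)))"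
  have finI: "finite I" using assms finite_subset by blast
  have dep: "depends_on I {f. card {a\<in>I. f a} = 1}"
    unfolding depends_on_def
  proof (intro allI impI)
    fix f g :: "'a \<Rightarrow> bool" assume "\<forall>x\<in>I. f x = g x"
    then have "{a\<in>I. f a} = {a\<in>I. g a}" by auto
    then show "(f \<in> {f. card {a\<in>I. f a} = 1}) = (g \<in> {f. card {a\<in>I. f a} = 1})" by simp
  qed
  \<comment> \<open>Here \<open>{x = a}\<close> holds the single Boolean \<open>x = a\<close>. Thus
    \<open>G a\<close> says that \<open>a\<close> is the only success in \<open>I\<close>, in the
    form of a product set.\<close>
  define G where "G a = (\<Pi> x\<in>I. {x = a})" for a
  have G: "f \<in> G a \<longleftrightarrow> {x\<in>I. f x} = {a}" if "a \<in> I" for f a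
    using that unfolding G_def by auto
  have eq: "{f. card {a\<in>I. f a} = 1} = (\<Union>a\<in>I. G a)"
  proof (intro equalityI subsetI)
    fix f assume "f \<in> {f. card {a\<in>I. f a} = 1}"
    then obtain a where a: "{a\<in>I. f a} = {a}" by (auto simp: card_1_singleton_iff)
    then have "a \<in> I" by auto
    then show "f \<in> (\<Union>a\<in>I. G a)" using G a by auto
  next
    fix f assume "f \<in> (\<Union>a\<in>I. G a)"
    then obtain a where "a \<in> I" "{x\<in>I. f x} = {a}" using G by auto
    then show "f \<in> {f. card {a\<in>I. f a} = 1}" by simp
  qed
  have PG: "?P (G a) \<ge> p a * 4 powr (- s)" if a: "a \<in> I" for a
  proof -
    have "sum p (I-{a}) \<le> s"
      unfolding s_def using finI p by (intro sum_mono2) auto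
    then have "4 powr (- s) \<le> 4 powr (\<Sum>x\<in>I-{a}. - p x)"
      by (simp add: sum_negf)
    also have "\<dots> = (\<Prod>x\<in>I-{a}. 4 powr (- p x))"
      using finI by (subst powr_sum) auto
    also have "\<dots> \<le> (\<Prod>x\<in>I-{a}. if x = a then p x else 1 - p x)"
      by (rule prod_mono) (use p four_powr_minus_le in auto)
    finally have "p a * 4 powr (- s) \<le> p a * (\<Prod>x\<in>I-{a}. if x = a then p x else 1 - p x)"
      using p[OF a] by (intro mult_left_mono) auto
    also have "\<dots> = (\<Prod>x\<in>I. if x = a then p x else 1 - p x)"
      using a finI by (subst (2) prod.remove[of _ a]) auto
    also have "\<dots> = (\<Prod>x\<in>I. measure_pmf.prob (bernoulli_pmf (p x)) {x = a})"
    proof (rule prod.cong)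
      fix x assume "x \<in> I"
      then have "0 \<le> p x" "p x \<le> 1" using p[of x] by auto
      then show "(if x = a then p x else 1 - p x) = measure_pmf.prob (bernoulli_pmf (p x)) {x = a}"
        by (cases "x = a") (auto simp: measure_pmf_single)
    qed simp
    also have "\<dots> = ?P (G a)"
      unfolding G_def by (rule measure_Pi_pmf_Pi[OF finI, symmetric])
    finally show ?thesis .
  qed
  have "s * 4 powr (- s) = (\<Sum>a\<in>I. p a * 4 powr (- s))"
    unfolding s_def by (simp add: sum_distrib_right)
  also have "\<dots> \<le> (\<Sum>a\<in>I. ?P (G a))"
    by (rule sum_mono) (rule PG)
  also have "\<dots> = ?P (\<Union>a\<in>I. G a)"
  proof (rule measure_pmf.finite_measure_finite_Union[symmetric])
    show "disjoint_family_on G I"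
      unfolding disjoint_family_on_def
    proof (intro ballI impI equals0I)
      fix a a' f assume "a \<in> I" "a' \<in> I" "a \<noteq> a'" "f \<in> G a \<inter> G a'"
      then have "{x \<in> I. f x} = {a}" "{x \<in> I. f x} = {a'}" using G by auto
      then show False using \<open>a \<noteq> a'\<close> by simp
    qed
  qed (use finI in auto)
  also have "\<dots> = measure_pmf.prob (Pi_pmf A False (\<lambda>a. bernoulli_pmf (p a))) {f. card {a\<in>I. f a} = 1}"
    unfolding eq[symmetric] by (rule prob_Pi_pmf_subset[OF assms(1,2) dep, symmetric])
  finally show ?thesis .
qed

text \<open>Used to code patterns with at most \<open>2 ^ L\<close> stations by lists of length
  exactly \<open>2 ^ L\<close>, which are easy to count.\<close>

lemma exists_padded_list:
  assumes "finite X" "X \<noteq> {}" "card X \<le> m"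
  shows "\<exists>xs. set xs = X \<and> length xs = m"
proof -
  obtain ys where ys: "set ys = X" "distinct ys" using finite_distinct_list[OF assms(1)] by auto
  obtain x where "x \<in> X" using assms(2) by auto
  then have "set (replicate (m - length ys) x @ ys) = X" using ys by auto
  moreover have "length (replicate (m - length ys) x @ ys) = m"
    using assms(3) distinct_card[OF ys(2)] ys(1) by simp
  ultimately show ?thesis by blast
qed

section \<open>Levels, window lengths and transmission densities\<close>

locale random_array =
  fixes n b M :: nat
  assumes b_pos: "1 \<le> b" and M_pos: "1 \<le> M"
begin

definition width :: "nat \<Rightarrow> nat" where
  "width i = nat \<lceil>real i powr (1 / real b)\<rceil>"

definition bound :: "nat \<Rightarrow> nat" where
  "bound i = M * 2 ^ i * width i"

definition level :: "nat \<Rightarrow> nat" where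
  "level j = (LEAST i. j \<le> bound i)"

text \<open>The factor \<open>b\<close> in the base of the power makes the densities of channel \<open>b\<close> sum to
  \<open>O(M L\<^bsup>1/b\<^esup>)\<close> with a constant independent of \<open>b\<close>; it costs only \<open>b\<^bsup>1/b\<^esup> \<le> 2\<close> per channel.\<close>

definition density :: "nat \<Rightarrow> nat \<Rightarrow> real" where
  "density \<beta> j = (1/2) ^ level j * real (b * level j) powr (- (real \<beta> / real b))"

lemma width_0 [simp]: "width 0 = 0"
  by (simp add: width_def)

lemma width_ge: "real i powr (1 / real b) \<le> real (width i)"
  unfolding width_def by linarith

lemma powr_root_ge_1: "1 \<le> i \<Longrightarrow> 1 \<le> real i powr (1 / real b)"
  by (rule ge_one_powr_ge_zero) auto

lemma width_pos: "1 \<le> i \<Longrightarrow> 1 \<le> width i"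
  using powr_root_ge_1[of i] width_ge[of i] by linarith

lemma width_le: "real (width i) \<le> 2 * real i powr (1 / real b)"
proof (cases "i = 0")
  case False
  then have "1 \<le> real i powr (1 / real b)" by (intro powr_root_ge_1) auto
  then show ?thesis unfolding width_def by linarith
qed simp

lemma width_mono: "i \<le> i' \<Longrightarrow> width i \<le> width i'"
  unfolding width_def by (intro nat_mono ceiling_mono powr_mono2) auto

lemma width_le_self: "width i \<le> i"
proof (cases "i = 0")
  case False
  then have "real i powr (1 / real b) \<le> real i powr 1"
    using b_pos by (intro powr_mono) auto
  then have "\<lceil>real i powr (1 / real b)\<rceil> \<le> int i"
    by (simp add: ceiling_le_iff)
  then show ?thesis unfolding width_def by linarith
qed simp

lemma bound_0 [simp]: "bound 0 = 0"
  by (simp add: bound_def)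

lemma two_bound_le_bound_Suc: "2 * bound i \<le> bound (Suc i)"
  using width_mono[of i "Suc i"] M_pos unfolding bound_def by simp

lemma bound_mono: "i \<le> i' \<Longrightarrow> bound i \<le> bound i'"
proof (erule lift_Suc_mono_le[of bound, rotated])
  show "bound i \<le> bound (Suc i)" for i
    using two_bound_le_bound_Suc[of i] by linarith
qed

lemma le_bound_self: "j \<le> bound j"
proof (cases "j = 0")
  case False
  have "j * 1 * 1 \<le> 2 ^ j * M * width j"
    using M_pos width_pos[of j] False less_exp[of j] by (intro mult_le_mono) auto
  then show ?thesis by (simp add: bound_def mult.commute)
qed simp

lemma le_bound_level: "j \<le> bound (level j)"
  unfolding level_def by (rule LeastI) (rule le_bound_self)

lemma level_le: "j \<le> bound i \<Longrightarrow> level j \<le> i"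
  unfolding level_def by (rule Least_le)

text \<open>Since \<open>bound 0 = 0\<close>, level 0 consists of position 0 alone, which is no
  local round of the array.\<close>

lemma level_pos: "1 \<le> j \<Longrightarrow> 1 \<le> level j"
  using le_bound_level[of j] by (cases "level j") auto

lemma level_eq_Suc: "bound i < j \<Longrightarrow> j \<le> bound (Suc i) \<Longrightarrow> level j = Suc i"
  using level_le[of j "Suc i"] le_bound_level[of j] bound_mono[of "level j" i]
  by linarith

lemma density_nonneg: "0 \<le> density \<beta> j"
  by (simp add: density_def)

lemma density_le_half:
  assumes "1 \<le> j"
  shows "density \<beta> j \<le> 1/2"
proof -
  have l: "1 \<le> level j" using level_pos assms .
  then have "1 \<le> b * level j" using b_pos by simp
  then have "1 \<le> real (b * level j)" by linarith
  then have "real (b * level j) powr (- (real \<beta> / real b)) \<le> real (b * level j) powr 0"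
    by (intro powr_mono) auto
  also have "\<dots> = 1"
    using l b_pos by simp
  finally have 1: "real (b * level j) powr (- (real \<beta> / real b)) \<le> 1" .
  have 2: "(1/2::real) ^ level j \<le> (1/2) ^ 1"
    using l by (intro power_decreasing) auto
  from mult_mono[OF 2 1] show ?thesis by (simp add: density_def)
qed

text \<open>Channel 0 is fictitious, the real ones being 1 to \<open>b\<close>: its density is
  \<open>(1/2) ^ level j\<close>, the start of the descent through the channels.\<close>

lemma density_0_ge:
  assumes "1 \<le> j" "j \<le> bound L"
  shows "(1/2) ^ L \<le> density 0 j"
proof -
  have "(1/2::real) ^ L \<le> (1/2) ^ level j"
    using level_le assms by (intro power_decreasing) auto
  moreover have "real (b * level j) \<noteq> 0" using level_pos[OF assms(1)] b_pos by auto
  ultimately show ?thesis unfolding density_def by simp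
qed

text \<open>The next channel costs exactly the factor
  \<open>real (b * level j) powr (- (1 / real b))\<close>, which is smallest at the top level
  \<open>L\<close>.\<close>

lemma density_Suc_ge:
  assumes "1 \<le> j" "j \<le> bound L"
  shows "density \<beta> j * real (b * L) powr (- (1 / real b)) \<le> density (Suc \<beta>) j"
proof -
  have l: "1 \<le> level j" "level j \<le> L" using level_pos level_le assms by auto
  then have "real (b * L) powr (- (1 / real b)) \<le> real (b * level j) powr (- (1 / real b))"
    using b_pos by (intro powr_mono2') auto
  then have "density \<beta> j * real (b * L) powr (- (1 / real b))
      \<le> density \<beta> j * real (b * level j) powr (- (1 / real b))"
    by (intro mult_left_mono density_nonneg)
  also have "\<dots> = density (Suc \<beta>) j"
  proof -
    have "- (real \<beta> / real b) + - (1 / real b) = - (real (Suc \<beta>) / real b)"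
      by (simp add: add_divide_distrib)
    then show ?thesis
      unfolding density_def by (metis mult.assoc powr_add)
  qed
  finally show ?thesis .
qed

text \<open>Bernoulli's inequality; this is the concavity of the \<open>b\<close>-th root.\<close>

lemma root_increment_ge:
  assumes "1 \<le> i"
  shows "real i powr (1 / real b) / (real b * real i)
    \<le> real i powr (1 / real b) - real (i - 1) powr (1 / real b)"
proof -
  define x where "x = 1 / (real b * real i)"
  have bi: "real b \<ge> 1" "real i \<ge> 1" using b_pos assms by auto
  then have "1 * 1 \<le> real b * real i" by (intro mult_mono) auto
  then have x: "0 \<le> x" "x \<le> 1" by (auto simp: x_def)
  have "1 + real b * (- x) \<le> (1 + (- x)) ^ b"
    using x by (intro Bernoulli_inequality) auto
  then have "1 - 1 / real i \<le> (1 - x) ^ b"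
    using bi by (simp add: x_def)
  then have "(1 - 1 / real i) powr (1 / real b) \<le> ((1 - x) ^ b) powr (1 / real b)"
    using bi by (intro powr_mono2) auto
  also have "\<dots> = 1 - x"
  \<comment> \<open>The case x = 1 means b = i = 1; the base \<open>1 - x\<close> is then 0 and the
    rewriting by \<open>powr_realpow\<close> does not apply.\<close>
  proof (cases "x = 1")
    case False
    then have "1 - x > 0" using x by simp
    then have "((1 - x) ^ b) powr (1 / real b) = (1 - x) powr (real b * (1 / real b))"
      by (simp only: powr_realpow[symmetric] powr_powr)
    then show ?thesis using bi \<open>1 - x > 0\<close> by simp
  qed (use b_pos in \<open>simp add: power_0_left\<close>)
  finally have "real i powr (1 / real b) * (1 - 1 / real i) powr (1 / real b)
    \<le> real i powr (1 / real b) * (1 - x)"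
    by (intro mult_left_mono) auto
  moreover have "real i powr (1 / real b) * (1 - 1 / real i) powr (1 / real b)
     = real (i - 1) powr (1 / real b)"
  proof -
    have "real i powr (1 / real b) * (1 - 1 / real i) powr (1 / real b) =
        (real i * (1 - 1 / real i)) powr (1 / real b)"
      using bi by (intro powr_mult[symmetric])
    also have "real i * (1 - 1 / real i) = real (i - 1)"
      using bi assms by (simp add: field_simps of_nat_diff)
    finally show ?thesis .
  qed
  ultimately show ?thesis
    by (simp add: x_def algebra_simps)
qed

text \<open>Level l has at most \<open>M * 2 ^ l * width l\<close> rounds, of density
  \<open>(1/2) ^ l / (b * l)\<close> on channel \<open>b\<close>. By
  \<open>root_increment_ge\<close> their sum is at most 2 M times the increment of the b-th root
  from l - 1 to l, and these increments telescope.\<close>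

lemma sum_density_le:
  "(\<Sum>j=1..bound L. density b j) \<le> 2 * real M * real L powr (1 / real b)"
proof (induction L)
  case (Suc L)
  let ?r = "1 / real b"
  define l where "l = real (Suc L)"
  have l: "l \<ge> 1" "l > 0" by (auto simp: l_def)
  have d: "density b j = (1/2) ^ Suc L / (real b * l)" if "j \<in> {bound L<..bound (Suc L)}" for j
  proof -
    have "level j = Suc L" using that level_eq_Suc by auto
    then show ?thesis unfolding density_def l_def using b_pos
      by (simp add: powr_minus_divide distrib_left)
  qed
  have "(\<Sum>j=1..bound (Suc L). density b j) =
      (\<Sum>j=1..bound L. density b j) + (\<Sum>j\<in>{bound L<..bound (Suc L)}. density b j)"
  proof -
    have eq: "{1..bound (Suc L)} = {1..bound L} \<union> {bound L<..bound (Suc L)}"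
      using bound_mono[of L "Suc L"] by auto
    show ?thesis unfolding eq by (rule sum.union_disjoint) auto
  qed
  also have "(\<Sum>j\<in>{bound L<..bound (Suc L)}. density b j) =
      real (bound (Suc L) - bound L) * ((1/2) ^ Suc L / (real b * l))"
    using d by simp
  also have "\<dots> \<le> real (bound (Suc L)) * ((1/2) ^ Suc L / (real b * l))"
    using l b_pos by (intro mult_right_mono) auto
  also have "\<dots> = real M * (real (width (Suc L)) / (real b * l))"
  proof -
    have "2 ^ Suc L * (1/2::real) ^ Suc L = 1"
      by (simp only: power_mult_distrib[symmetric]) simp
    moreover have "real (bound (Suc L)) * ((1/2) ^ Suc L / (real b * l)) =
        (2 ^ Suc L * (1/2) ^ Suc L) * (real M * (real (width (Suc L)) / (real b * l)))"
      unfolding bound_def by (simp only: of_nat_mult of_nat_power of_nat_numeral times_divide_eq_right ac_simps)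
    ultimately show ?thesis by (simp only: mult_1_left)
  qed
  also have "\<dots> \<le> real M * (2 * l powr ?r / (real b * l))"
    using l b_pos width_le[of "Suc L"] unfolding l_def
    by (intro mult_left_mono divide_right_mono) auto
  also have "\<dots> = 2 * real M * (l powr ?r / (real b * l))" by simp
  also have "\<dots> \<le> 2 * real M * (l powr ?r - real L powr ?r)"
    using root_increment_ge[of "Suc L"] unfolding l_def by (intro mult_left_mono) auto
  finally show ?case using Suc.IH unfolding l_def by (simp add: algebra_simps)
qed simp

section \<open>The random array and its failure probability on one pattern\<close>

definition tape :: "nat \<Rightarrow> (nat \<times> nat \<times> nat \<Rightarrow> bool) pmf" where
  "tape len = Pi_pmf ({1..n} \<times> {1..b} \<times> {1..len}) False (\<lambda>(u, \<beta>, j). bernoulli_pmf (density \<beta> j))"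

text \<open>The stations \<open>D\<close> are activated \<open>off u\<close> steps after the first one; only steps in the
  second half of \<open>{1..bound L}\<close> are considered.\<close>

definition asleep :: "nat \<Rightarrow> nat set \<Rightarrow> (nat \<Rightarrow> nat) \<Rightarrow> (nat \<times> nat \<times> nat \<Rightarrow> bool) set" where
  "asleep L D off = {f. \<forall>t\<in>{M * 2 ^ (L - 1) * width L<..bound L}. \<forall>\<beta>\<in>{1..b}.
      card {u\<in>D. off u < t \<and> f (u, \<beta>, t - off u)} \<noteq> 1}"

lemma root_b_le_2: "real b powr (1 / real b) \<le> 2"
proof -
  have "real b \<le> 2 ^ b" using less_exp[of b] by (metis less_imp_le of_nat_le_iff of_nat_numeral of_nat_power)
  then have "real b powr (1 / real b) \<le> (2 ^ b) powr (1 / real b)"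
    by (intro powr_mono2) auto
  also have "\<dots> = 2 powr (real b * (1 / real b))"
    by (simp only: powr_realpow[symmetric] powr_powr zero_less_numeral)
  also have "\<dots> = 2" using b_pos by simp
  finally show ?thesis .
qed

text \<open>Take the least channel \<beta> \<ge> 1 with value at most 8. Its predecessor is channel
  0 or has a value above 8, so in either case at least 1/2, and one step loses at most the factor
  \<open>r\<close>.\<close>

lemma channel_in_range:
  fixes \<Psi> :: "nat \<Rightarrow> real"
  assumes "\<Psi> b \<le> 8" "1/2 \<le> \<Psi> 0" "0 \<le> r" and step: "\<And>\<beta>. \<Psi> \<beta> * r \<le> \<Psi> (Suc \<beta>)"
  shows "\<exists>\<beta>\<in>{1..b}. \<Psi> \<beta> \<le> 8 \<and> r / 2 \<le> \<Psi> \<beta>"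
proof -
  define \<beta> where "\<beta> = (LEAST \<beta>. 1 \<le> \<beta> \<and> \<Psi> \<beta> \<le> 8)"
  have \<beta>: "1 \<le> \<beta> \<and> \<Psi> \<beta> \<le> 8"
    unfolding \<beta>_def by (rule LeastI[of _ b]) (use assms b_pos in auto)
  have "\<beta> \<le> b" unfolding \<beta>_def by (rule Least_le) (use assms b_pos in auto)
  from \<beta> obtain \<gamma> where \<gamma>: "\<beta> = Suc \<gamma>" by (cases \<beta>) auto
  have "1/2 \<le> \<Psi> \<gamma>"
  proof (cases "\<gamma> = 0")
    case False
    have "\<not> (1 \<le> \<gamma> \<and> \<Psi> \<gamma> \<le> 8)"
      using not_less_Least[of \<gamma> "\<lambda>\<beta>. 1 \<le> \<beta> \<and> \<Psi> \<beta> \<le> 8"] \<gamma> unfolding \<beta>_def by simp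
    then show ?thesis using False by auto
  qed (use assms in simp)
  then have "1/2 * r \<le> \<Psi> \<gamma> * r" using assms(3) by (intro mult_right_mono)
  also have "\<dots> \<le> \<Psi> \<beta>" using step \<gamma> by simp
  finally show ?thesis using \<beta> \<open>\<beta> \<le> b\<close> by auto
qed

text \<open>On a channel in range the success bound is at least a quarter of
  \<open>real L powr (- (1 / real b))\<close> times \<open>4 powr (- 8)\<close>, which is
  \<epsilon>; then 1 - \<epsilon> \<le> exp (-\<epsilon>). If \<Psi> b > 8, the right-hand side is
  at least 1.\<close>

lemma channel_success_ge:
  fixes \<Psi> :: "nat \<Rightarrow> real"
  assumes "1 \<le> L" and nonneg: "\<And>\<beta>. 0 \<le> \<Psi> \<beta>" and "1/2 \<le> \<Psi> 0"
    and step: "\<And>\<beta>. \<Psi> \<beta> * real (b * L) powr (- (1 / real b)) \<le> \<Psi> (Suc \<beta>)"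
  defines "\<epsilon> \<equiv> (1/4) ^ 9 * real L powr (- (1 / real b))"
  shows "\<exists>\<beta>\<in>{1..b}. 1 - \<Psi> \<beta> * 4 powr (- \<Psi> \<beta>) \<le> exp (- (\<epsilon> * (1 - \<Psi> b / 8)))"
proof (cases "\<Psi> b \<le> 8")
  case False
  have "\<epsilon> * (1 - \<Psi> b / 8) \<le> 0"
    using False by (intro mult_nonneg_nonpos) (auto simp: \<epsilon>_def)
  then have "1 \<le> exp (- (\<epsilon> * (1 - \<Psi> b / 8)))" by simp
  moreover have "1 - \<Psi> b * 4 powr (- \<Psi> b) \<le> 1" using nonneg[of b] by simp
  ultimately have "1 - \<Psi> b * 4 powr (- \<Psi> b) \<le> exp (- (\<epsilon> * (1 - \<Psi> b / 8)))" by linarith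
  then show ?thesis using b_pos by (intro bexI[of _ b]) auto
next
  case True
  define r where "r = real (b * L) powr (- (1 / real b))"
  have "0 \<le> r" by (simp add: r_def)
  from channel_in_range[OF True assms(3) this step[folded r_def]]
  obtain \<beta> where \<beta>: "\<beta> \<in> {1..b}" "\<Psi> \<beta> \<le> 8" "r / 2 \<le> \<Psi> \<beta>" by auto
  have "real b powr (- (1 / real b)) \<ge> 1/2"
  proof -
    have "0 < real b powr (1 / real b)" using b_pos by simp
    then have "1 / 2 \<le> 1 / (real b powr (1 / real b))"
      using root_b_le_2 by (intro divide_left_mono) auto
    then show ?thesis by (simp add: powr_minus_divide)
  qed
  then have "1/2 * real L powr (- (1 / real b)) \<le> real b powr (- (1 / real b)) * real L powr (- (1 / real b))"
    by (rule mult_right_mono) simp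
  then have "1/2 * real L powr (- (1 / real b)) \<le> r"
    unfolding r_def of_nat_mult by (subst powr_mult) auto
  then have 1: "1/4 * real L powr (- (1 / real b)) \<le> \<Psi> \<beta>"
    using \<beta>(3) by linarith
  have "4 powr (- 8) \<le> 4 powr (- \<Psi> \<beta>)" using \<beta>(2) by (intro powr_mono) auto
  moreover have "4 powr (- 8) = (1/4 :: real) ^ 8"
    by (simp only: powr_neg_numeral power_one_over zero_less_numeral)
  ultimately have 2: "(1/4) ^ 8 \<le> 4 powr (- \<Psi> \<beta>)" by simp
  have "(1/4 :: real) ^ 9 = 1/4 * (1/4) ^ 8" by (simp add: power_one_over)
  then have "\<epsilon> = (1/4 * real L powr (- (1 / real b))) * (1/4) ^ 8"
    unfolding \<epsilon>_def by (simp only: ac_simps)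
  also have "\<dots> \<le> \<Psi> \<beta> * 4 powr (- \<Psi> \<beta>)"
    using 1 2 nonneg by (intro mult_mono) auto
  finally have "1 - \<Psi> \<beta> * 4 powr (- \<Psi> \<beta>) \<le> 1 + (- \<epsilon>)" by simp
  also have "\<dots> \<le> exp (- \<epsilon>)" by (rule exp_ge_add_one_self)
  also have "\<dots> \<le> exp (- (\<epsilon> * (1 - \<Psi> b / 8)))"
  proof -
    have "\<epsilon> * (1 - \<Psi> b / 8) \<le> \<epsilon> * 1"
      using nonneg[of b] by (intro mult_left_mono) (auto simp: \<epsilon>_def)
    then show ?thesis by simp
  qed
  finally show ?thesis using \<beta>(1) by blast
qed

text \<open>Bounding the failure probability of step \<open>t\<close> by \<open>exp (- \<epsilon> (1 - \<Psi> t b / 8))\<close>, which is trivial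
  when \<open>\<Psi> t b > 8\<close>, lets the bound on the average of \<open>\<Psi> t b\<close> enter through a sum in the exponent.\<close>

lemma prob_asleep_le:
  assumes L: "1 \<le> L" and len: "bound L \<le> len" and D: "D \<subseteq> {1..n}" "card D \<le> 2 ^ L"
    and early: "2 ^ (L - 1) \<le> card {u\<in>D. off u \<le> bound (L - 1)}"
  shows "measure_pmf.prob (tape len) (asleep L D off) \<le> exp (- ((1/4) ^ 10 * real (M * 2 ^ L)))"
proof -
  define H where "H = M * 2 ^ (L - 1) * width L"
  define W where "W = {H<..bound L}"
  define A where "A = {1..n} \<times> {1..b} \<times> {1..len}"
  define \<Psi> where "\<Psi> t \<beta> = (\<Sum>u\<in>{u\<in>D. off u < t}. density \<beta> (t - off u))" for t \<beta>
  define \<epsilon> where "\<epsilon> = (1/4) ^ 9 * real L powr (- (1 / real b))"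
  define R where "R = real L powr (1 / real b)"
  have finD: "finite D" using D(1) finite_subset by blast
  have two_H: "bound L = 2 * H"
    using L by (cases L) (auto simp: bound_def H_def)
  have bH: "bound (L - 1) \<le> H"
    unfolding bound_def H_def using width_mono[of "L - 1" L] by simp
  have R1: "1 \<le> R" unfolding R_def using L by (rule powr_root_ge_1)
  have \<epsilon>R: "\<epsilon> * R = (1/4) ^ 9"
    unfolding \<epsilon>_def R_def using L by (simp add: powr_add[symmetric])
  have \<epsilon>0: "0 \<le> \<epsilon>" by (simp add: \<epsilon>_def)
  have card_W: "card W = H" by (simp add: W_def two_H)
  have H_ge: "real M * 2 ^ (L - 1) * R \<le> real H"
    unfolding H_def R_def using width_ge[of L] by (simp add: mult_left_mono)

  \<comment> \<open>At least \<open>2 ^ (L - 1)\<close> stations are activated by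
    \<open>bound (L - 1)\<close>, hence no later than \<open>H\<close>, before every step of
    \<open>W\<close>. Each has level at most \<open>L\<close> and adds at least
    \<open>(1/2) ^ L\<close>.\<close>
  have \<Psi>0: "1/2 \<le> \<Psi> t 0" if t: "t \<in> W" for t
  proof -
    let ?S = "{u\<in>D. off u \<le> bound (L - 1)}"
    have "(1/2::real) = 2 ^ (L - 1) * (1/2) ^ L"
      using L by (cases L) (auto simp: power_one_over)
    also have "\<dots> \<le> real (card ?S) * (1/2) ^ L"
      using early by (intro mult_right_mono) (auto simp flip: of_nat_le_iff)
    also have "\<dots> = (\<Sum>u\<in>?S. (1/2) ^ L)" by simp
    also have "\<dots> \<le> (\<Sum>u\<in>?S. density 0 (t - off u))"
      using t bH by (intro sum_mono density_0_ge) (auto simp: W_def)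
    also have "\<dots> \<le> \<Psi> t 0"
      unfolding \<Psi>_def using finD t bH by (intro sum_mono2) (auto simp: W_def density_nonneg)
    finally show ?thesis .
  qed
  have \<Psi>_step: "\<Psi> t \<beta> * real (b * L) powr (- (1 / real b)) \<le> \<Psi> t (Suc \<beta>)" if t: "t \<in> W" for t \<beta>
    unfolding \<Psi>_def sum_distrib_right
    using t by (intro sum_mono density_Suc_ge) (auto simp: W_def)
  have "\<forall>t\<in>W. \<exists>\<beta>\<in>{1..b}. 1 - \<Psi> t \<beta> * 4 powr (- \<Psi> t \<beta>) \<le> exp (- (\<epsilon> * (1 - \<Psi> t b / 8)))"
  proof
    fix t assume t: "t \<in> W"
    show "\<exists>\<beta>\<in>{1..b}. 1 - \<Psi> t \<beta> * 4 powr (- \<Psi> t \<beta>) \<le> exp (- (\<epsilon> * (1 - \<Psi> t b / 8)))"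
      unfolding \<epsilon>_def
      by (rule channel_success_ge[OF L _ \<Psi>0[OF t] \<Psi>_step[OF t]])
         (auto simp: \<Psi>_def density_nonneg intro: sum_nonneg)
  qed
  then obtain \<beta> where \<beta>: "\<And>t. t \<in> W \<Longrightarrow> \<beta> t \<in> {1..b}"
    "\<And>t. t \<in> W \<Longrightarrow> 1 - \<Psi> t (\<beta> t) * 4 powr (- \<Psi> t (\<beta> t)) \<le> exp (- (\<epsilon> * (1 - \<Psi> t b / 8)))"
    by (metis (no_types, lifting))

  \<comment> \<open>The channel \<beta> t is fixed by the pattern, before the array is drawn, so
    \<open>I t\<close> is a deterministic set of bits.\<close>
  define slot where "slot t u = (u, \<beta> t, t - off u)" for t u
  define I where "I t = slot t ` {u\<in>D. off u < t}" for t
  define E where "E t = - {f. card {a\<in>I t. f a} = 1}" for t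
  have inj: "inj_on (slot t) X" for t X by (auto simp: inj_on_def slot_def)
  have card_I: "card {a\<in>I t. f a} = card {u\<in>D. off u < t \<and> f (u, \<beta> t, t - off u)}" for t f
  proof -
    have "{a\<in>I t. f a} = slot t ` {u\<in>D. off u < t \<and> f (u, \<beta> t, t - off u)}"
      by (auto simp: I_def slot_def)
    then show ?thesis by (simp only: card_image[OF inj])
  qed
  have I_A: "I t \<subseteq> A" if "t \<in> W" for t
    using \<beta>(1)[OF that] D len that by (auto simp: I_def slot_def A_def W_def)
  have finA: "finite A" by (simp add: A_def)
  have finW: "finite W" by (simp add: W_def)
  have tape: "tape len = Pi_pmf A False (\<lambda>a. bernoulli_pmf (case a of (u, \<beta>, j) \<Rightarrow> density \<beta> j))"
    unfolding tape_def A_def by (intro arg_cong[of _ _ "Pi_pmf _ _"] ext) auto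
  have PE: "measure_pmf.prob (tape len) (E t) \<le> exp (- (\<epsilon> * (1 - \<Psi> t b / 8)))" if t: "t \<in> W" for t
  proof -
    let ?s = "\<Sum>a\<in>I t. case a of (u, \<beta>, j) \<Rightarrow> density \<beta> j"
    have s: "?s = \<Psi> t (\<beta> t)"
      unfolding I_def \<Psi>_def by (subst sum.reindex[OF inj]) (simp add: slot_def)
    have "?s * 4 powr (- ?s) \<le> measure_pmf.prob (tape len) {f. card {a\<in>I t. f a} = 1}"
      unfolding tape
      by (rule prob_exactly_one_ge[OF finA I_A[OF t]])
         (auto simp: I_def slot_def density_nonneg intro!: density_le_half[simplified])
    then have "measure_pmf.prob (tape len) (E t) \<le> 1 - \<Psi> t (\<beta> t) * 4 powr (- \<Psi> t (\<beta> t))"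
      unfolding s E_def using measure_pmf.prob_compl[of "{f. card {a\<in>I t. f a} = 1}" "tape len"]
      by (simp add: Compl_eq_Diff_UNIV)
    with \<beta>(2)[OF t] show ?thesis by linarith
  qed

  \<comment> \<open>After swapping the sums, each station meets each of its local rounds at most
    once, so \<open>sum_density_le\<close> bounds its share.\<close>
  have sum_\<Psi>: "(\<Sum>t\<in>W. \<Psi> t b) \<le> 4 * real H"
  proof -
    have "(\<Sum>t\<in>W. \<Psi> t b) = (\<Sum>t\<in>W. \<Sum>u\<in>D. if off u < t then density b (t - off u) else 0)"
      unfolding \<Psi>_def by (simp only: sum.inter_filter[OF finD])
    also have "\<dots> = (\<Sum>u\<in>D. \<Sum>t\<in>W. if off u < t then density b (t - off u) else 0)"
      by (rule sum.swap)
    also have "\<dots> \<le> (\<Sum>u\<in>D. 2 * real M * R)"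
    proof (rule sum_mono)
      fix u assume "u \<in> D"
      have "(\<Sum>t\<in>W. if off u < t then density b (t - off u) else 0)
          = (\<Sum>t\<in>{t\<in>W. off u < t}. density b (t - off u))"
        by (simp only: sum.inter_filter[OF finW])
      also have "\<dots> = sum (density b) ((\<lambda>t. t - off u) ` {t\<in>W. off u < t})"
        by (subst sum.reindex) (auto simp: inj_on_def)
      also have "\<dots> \<le> (\<Sum>j=1..bound L. density b j)"
        by (intro sum_mono2) (auto simp: W_def density_nonneg)
      also have "\<dots> \<le> 2 * real M * R" unfolding R_def by (rule sum_density_le)
      finally show "(\<Sum>t\<in>W. if off u < t then density b (t - off u) else 0) \<le> 2 * real M * R" .
    qed
    also have "\<dots> = real (card D) * (2 * real M * R)" by simp
    also have "\<dots> \<le> 2 ^ L * (2 * real M * R)"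
      using D(2) R1 by (intro mult_right_mono) (auto simp flip: of_nat_le_iff)
    also have "\<dots> = 4 * (real M * 2 ^ (L - 1) * R)"
      using L by (cases L) auto
    also have "\<dots> \<le> 4 * real H" using H_ge by simp
    finally show ?thesis .
  qed

  have "asleep L D off \<subseteq> (\<Inter>t\<in>W. E t)"
  proof
    fix f assume f: "f \<in> asleep L D off"
    have "f \<in> E t" if t: "t \<in> W" for t
      using f t \<beta>(1)[OF t] unfolding E_def asleep_def W_def H_def
      by (auto simp: card_I)
    then show "f \<in> (\<Inter>t\<in>W. E t)" by blast
  qed
  then have "measure_pmf.prob (tape len) (asleep L D off) \<le> measure_pmf.prob (tape len) (\<Inter>t\<in>W. E t)"
    by (intro measure_pmf.finite_measure_mono) auto
  also have "\<dots> = (\<Prod>t\<in>W. measure_pmf.prob (tape len) (E t))"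
    unfolding tape
  proof (rule prob_Pi_pmf_INT_indep[OF finW finA I_A])
    \<comment> \<open>A bit determines its step: \<open>t\<close> is recovered from \<open>u\<close>
      and \<open>t - off u\<close>, as \<open>off u < t\<close> rules out truncated
      subtraction.\<close>
    show "disjoint_family_on I W"
      by (auto simp: disjoint_family_on_def I_def slot_def)
    show "depends_on (I t) (E t)" for t
      unfolding depends_on_def
    proof (intro allI impI)
      fix f g :: "nat \<times> nat \<times> nat \<Rightarrow> bool" assume "\<forall>x\<in>I t. f x = g x"
      then have "{a\<in>I t. f a} = {a\<in>I t. g a}" by auto
      then show "(f \<in> E t) = (g \<in> E t)" by (simp add: E_def)
    qed
  qed
  also have "\<dots> \<le> (\<Prod>t\<in>W. exp (- (\<epsilon> * (1 - \<Psi> t b / 8))))"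
    by (intro prod_mono) (auto intro: PE)
  also have "\<dots> = exp (\<Sum>t\<in>W. - (\<epsilon> * (1 - \<Psi> t b / 8)))"
    by (simp add: exp_sum finW)
  also have "(\<Sum>t\<in>W. - (\<epsilon> * (1 - \<Psi> t b / 8))) = - (\<epsilon> * (real H - (\<Sum>t\<in>W. \<Psi> t b) / 8))"
    by (simp add: sum_negf sum_distrib_left[symmetric] sum_subtractf sum_divide_distrib card_W)
  also have "exp \<dots> \<le> exp (- ((1/4) ^ 10 * real (M * 2 ^ L)))"
  proof -
    \<comment> \<open>The sum bound leaves H - 4H/8 = H/2, and \<epsilon> R is
      \<open>(1/4) ^ 9\<close>; the last factor 1/4 is this half and the half in
      \<open>2 ^ (L - 1)\<close>.\<close>
    have "(1/4) ^ 10 * real (M * 2 ^ L) = \<epsilon> * R * (real M * 2 ^ (L - 1)) / 2"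
      unfolding \<epsilon>R using L by (cases L) (auto simp: power_one_over)
    also have "\<dots> = \<epsilon> * ((real M * 2 ^ (L - 1) * R) / 2)" by simp
    also have "\<dots> \<le> \<epsilon> * (real H - (\<Sum>t\<in>W. \<Psi> t b) / 8)"
      using H_ge sum_\<Psi> by (intro mult_left_mono[OF _ \<epsilon>0]) linarith
    finally show ?thesis by simp
  qed
  finally show ?thesis .
qed

section \<open>Union bound over all activation patterns\<close>

lemma asleep_cong: "(\<And>u. u \<in> D \<Longrightarrow> off u = off' u) \<Longrightarrow> asleep L D off = asleep L D off'"
  unfolding asleep_def
  by (intro Collect_cong ball_cong refl arg_cong[of _ _ "\<lambda>X. card X \<noteq> 1"]) auto

text \<open>The number of coded patterns of level \<open>L\<close> and the failure probability of
  each are bounded by \<open>2 ^ L\<close>-th powers. The product of their bases is at most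
  \<open>q\<close>, so level \<open>L\<close> fails with probability at most
  \<open>q ^ 2 ^ L\<close>, hence at most \<open>q\<close>, and \<open>K\<close> levels stay below
  1.\<close>

lemma exists_waking_array:
  assumes len: "bound K \<le> len"
    and q: "\<And>L. L \<le> K \<Longrightarrow> real (n * Suc (bound L)) * exp (- ((1/4) ^ 10 * real M)) \<le> q"
    and "q \<le> 1" "real K * q < 1"
  shows "\<exists>f. \<forall>L D off. 1 \<le> L \<longrightarrow> L \<le> K \<longrightarrow> D \<subseteq> {1..n} \<longrightarrow> D \<noteq> {} \<longrightarrow> card D \<le> 2 ^ L \<longrightarrow>
    off ` D \<subseteq> {..bound L} \<longrightarrow> 2 ^ (L - 1) \<le> card {u\<in>D. off u \<le> bound (L - 1)} \<longrightarrow>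
    f \<notin> asleep L D off"
proof -
  let ?P = "measure_pmf.prob (tape len)"
  let ?e = "\<lambda>L. exp (- ((1/4) ^ 10 * real (M * 2 ^ L)))"
  define bad where "bad L xs = asleep L (fst ` set xs) (\<lambda>u. the (map_of xs u))" for L xs
  define cfg where "cfg L = {xs. set xs \<subseteq> {1..n} \<times> {..bound L} \<and> length xs = 2 ^ L}" for L
  \<comment> \<open>Only lists obeying the failure bound enter the union; those of admissible
    patterns are shown to be among them at the end.\<close>
  define cfg' where "cfg' L = {xs \<in> cfg L. ?P (bad L xs) \<le> ?e L}" for L
  have fin: "finite (cfg L)" for L
    unfolding cfg_def by (rule finite_lists_length_eq) auto
  then have fin': "finite (cfg' L)" for L unfolding cfg'_def by auto
  have card: "card (cfg' L) \<le> (n * Suc (bound L)) ^ 2 ^ L" for L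
  proof -
    have "card (cfg' L) \<le> card (cfg L)"
      by (rule card_mono[OF fin]) (auto simp: cfg'_def)
    also have "\<dots> = card ({1..n} \<times> {..bound L}) ^ 2 ^ L"
      unfolding cfg_def by (rule card_lists_length_eq) auto
    also have "card ({1..n} \<times> {..bound L}) = n * Suc (bound L)"
      by (simp only: card_cartesian_product card_atLeastAtMost card_atMost) simp
    finally show ?thesis .
  qed
  define U where "U = (\<Union>L\<in>{1..K}. \<Union>xs\<in>cfg' L. bad L xs)"
  have "?P U \<le> (\<Sum>L\<in>{1..K}. ?P (\<Union>xs\<in>cfg' L. bad L xs))"
    unfolding U_def by (rule measure_pmf.finite_measure_subadditive_finite) auto
  also have "\<dots> \<le> (\<Sum>L\<in>{1..K}. q)"
  proof (rule sum_mono)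
    fix L assume L: "L \<in> {1..K}"
    have "?P (\<Union>xs\<in>cfg' L. bad L xs) \<le> (\<Sum>xs\<in>cfg' L. ?P (bad L xs))"
      by (rule measure_pmf.finite_measure_subadditive_finite) (use fin' in auto)
    also have "\<dots> \<le> (\<Sum>xs\<in>cfg' L. ?e L)"
      by (rule sum_mono) (simp add: cfg'_def)
    also have "\<dots> = real (card (cfg' L)) * ?e L" by simp
    also have "\<dots> \<le> real ((n * Suc (bound L)) ^ 2 ^ L) * ?e L"
      by (rule mult_right_mono) (use card in \<open>simp_all only: of_nat_le_iff exp_ge_zero\<close>)
    also have "?e L = exp (real (2 ^ L) * - ((1/4) ^ 10 * real M))"
      by (simp add: ac_simps)
    also have "\<dots> = exp (- ((1/4) ^ 10 * real M)) ^ 2 ^ L"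
      by (rule exp_of_nat_mult)
    also have "real ((n * Suc (bound L)) ^ 2 ^ L) * \<dots> =
        (real (n * Suc (bound L)) * exp (- ((1/4) ^ 10 * real M))) ^ 2 ^ L"
      by (simp only: of_nat_power flip: power_mult_distrib)
    also have "\<dots> \<le> q ^ 2 ^ L"
      using L by (intro power_mono q) auto
    also have "\<dots> \<le> q ^ 1"
    proof (rule power_decreasing)
      have "0 \<le> real (n * Suc (bound L)) * exp (- ((1/4) ^ 10 * real M))" by simp
      also have "\<dots> \<le> q" using L by (intro q) simp
      finally show "0 \<le> q" .
    qed (use assms in auto)
    finally show "?P (\<Union>xs\<in>cfg' L. bad L xs) \<le> q" by simp
  qed
  also have "\<dots> < 1" using assms by simp
  finally have "?P U < 1" .
  then have "U \<noteq> UNIV" by auto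
  then obtain f where f: "f \<notin> U" by auto
  have "f \<notin> asleep L D off" if L: "1 \<le> L" "L \<le> K" and D: "D \<subseteq> {1..n}" "D \<noteq> {}" "card D \<le> 2 ^ L"
    and off: "off ` D \<subseteq> {..bound L}" and early: "2 ^ (L - 1) \<le> card {u\<in>D. off u \<le> bound (L - 1)}" for L D off
  proof -
    have finD: "finite D" using D(1) finite_subset by blast
    obtain xs where xs: "set xs = (\<lambda>u. (u, off u)) ` D" "length xs = 2 ^ L"
      using exists_padded_list[of "(\<lambda>u. (u, off u)) ` D" "2 ^ L"] D finD
      by (auto simp: card_image inj_on_def)
    \<comment> \<open>Repetitions from the padding are harmless, since all pairs of the list lie on
      the graph of \<open>off\<close>.\<close>
    have "map_of xs u = Some (off u)" if "u \<in> D" for u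
    proof -
      have "(u, off u) \<in> set xs" using that xs by auto
      then obtain v where v: "map_of xs u = Some v" using weak_map_of_SomeI by metis
      then have "(u, v) \<in> set xs" by (rule map_of_SomeD)
      then show ?thesis using v xs by auto
    qed
    then have "asleep L D (\<lambda>u. the (map_of xs u)) = asleep L D off"
      by (intro asleep_cong) simp
    moreover have "fst ` set xs = D" unfolding xs by force
    ultimately have bad: "bad L xs = asleep L D off" unfolding bad_def by simp
    have "bound L \<le> len" using bound_mono[OF L(2)] len by simp
    then have "?P (bad L xs) \<le> ?e L"
      unfolding bad by (rule prob_asleep_le[OF L(1) _ D(1,3) early])
    moreover have "xs \<in> cfg L" unfolding cfg_def using xs D off by auto
    ultimately have "xs \<in> cfg' L" unfolding cfg'_def by simp
    then have "bad L xs \<subseteq> U" unfolding U_def using L by auto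
    then show ?thesis using f bad by auto
  qed
  then show ?thesis by blast
qed

section \<open>Waking up an arbitrary pattern\<close>

text \<open>With time counted from the first activation, \<open>L\<close> is the least positive
  level whose window sees at most \<open>2 ^ L\<close> activations. Minimality gives the many early
  stations required by \<open>f\<close>, and as they number at most \<open>k\<close>, also
  \<open>2 ^ L \<le> 2 * k\<close>.\<close>

lemma wakes_within_bound:
  assumes f: "\<And>L D off. 1 \<le> L \<Longrightarrow> L \<le> K \<Longrightarrow> D \<subseteq> {1..n} \<Longrightarrow> D \<noteq> {} \<Longrightarrow> card D \<le> 2 ^ L \<Longrightarrow>
      off ` D \<subseteq> {..bound L} \<Longrightarrow> 2 ^ (L - 1) \<le> card {u\<in>D. off u \<le> bound (L - 1)} \<Longrightarrow>
      f \<notin> asleep L D off"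
    and n: "n < 2 ^ K" and k: "k \<le> n" and S: "S \<subseteq> {1..n}" "S \<noteq> {}" "card S \<le> k"
  shows "\<exists>L. 2 ^ L \<le> 2 * k \<and>
    wakes_within b (\<lambda>u \<beta> j. f (u, \<beta>, j)) (bound K) S \<sigma> (real (bound L))"
proof -
  have finS: "finite S" using S(1) finite_subset by blast
  define s where "s = first_activation S \<sigma>"
  have s_le: "s \<le> \<sigma> u" if "u \<in> S" for u
    unfolding s_def first_activation_def using that finS by auto
  have "s \<in> \<sigma> ` S"
    unfolding s_def first_activation_def by (rule Min_in) (use finS S(2) in auto)
  then obtain u0 where u0: "u0 \<in> S" "\<sigma> u0 = s" by auto
  define D where "D L = {u\<in>S. \<sigma> u - s \<le> bound L}" for L
  have D_S: "D L \<subseteq> S" and finD: "finite (D L)" and u0_D: "u0 \<in> D L" for L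
    using finS u0 by (auto simp: D_def)
  have card_D: "card (D L) \<le> k" for L
    using card_mono[OF finS D_S[of L]] S(3) by simp
  define L where "L = (LEAST L. 1 \<le> L \<and> card (D L) \<le> 2 ^ L)"
  have "card (D 0) \<noteq> 0" using u0_D[of 0] finD[of 0] by auto
  then have "1 \<le> k" using card_D[of 0] by linarith
  have "1 \<le> L \<and> card (D L) \<le> 2 ^ L"
    unfolding L_def
    by (rule LeastI[of _ k]) (use \<open>1 \<le> k\<close> card_D[of k] less_exp[of k] in linarith)
  then have L: "1 \<le> L" "card (D L) \<le> 2 ^ L" by auto
  have early: "2 ^ (L - 1) \<le> card (D (L - 1))" and "2 ^ L \<le> 2 * k"
  proof -
    show *: "2 ^ (L - 1) \<le> card (D (L - 1))"
    \<comment> \<open>Minimality says nothing about level 0; there the first activated station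
      \<open>u0\<close> supplies the one station needed.\<close>
    proof (cases "L = 1")
      case True
      have "0 < card (D 0)" using u0_D finD by (auto simp: card_gt_0_iff)
      then show ?thesis using True by simp
    next
      case False
      have "\<not> (1 \<le> L - 1 \<and> card (D (L - 1)) \<le> 2 ^ (L - 1))"
        using not_less_Least[of "L - 1" "\<lambda>L. 1 \<le> L \<and> card (D L) \<le> 2 ^ L"] L(1) unfolding L_def[symmetric] by simp
      then show ?thesis using False L(1) by auto
    qed
    have "2 ^ L = 2 * (2::nat) ^ (L - 1)" using L(1) by (cases L) auto
    also have "\<dots> \<le> 2 * k" using * card_D[of "L - 1"] by simp
    finally show "2 ^ L \<le> 2 * k" .
  qed
  have "L \<le> K"
  proof -
    have "(2::nat) ^ L < 2 ^ Suc K" using \<open>2 ^ L \<le> 2 * k\<close> k n by simp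
    then have "L < Suc K" by (rule power_less_imp_less_exp[rotated]) simp
    then show ?thesis by simp
  qed
  have eq: "{u\<in>D L. \<sigma> u - s \<le> bound (L - 1)} = D (L - 1)"
    using bound_mono[of "L - 1" L] by (auto simp: D_def)
  have "f \<notin> asleep L (D L) (\<lambda>u. \<sigma> u - s)"
    by (rule f[OF L(1) \<open>L \<le> K\<close> _ _ L(2)])
       (use u0_D[of L] early eq D_S[of L] S(1) in \<open>auto simp: D_def\<close>)
  then obtain t \<beta> where t: "M * 2 ^ (L - 1) * width L < t" "t \<le> bound L" and \<beta>: "\<beta> \<in> {1..b}"
    and one: "card {u\<in>D L. \<sigma> u - s < t \<and> f (u, \<beta>, t - (\<sigma> u - s))} = 1"
    unfolding asleep_def by auto
  let ?T = "\<lambda>u \<beta> j. f (u, \<beta>, j)"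
  \<comment> \<open>Stations outside \<open>D L\<close> are activated after step
    \<open>s + t\<close>, because \<open>t \<le> bound L\<close>, so they cannot interfere.\<close>
  have "{u\<in>S. transmits ?T (bound K) S \<sigma> u \<beta> (s + t)} =
      {u\<in>D L. \<sigma> u - s < t \<and> f (u, \<beta>, t - (\<sigma> u - s))}"
  proof -
    have "transmits ?T (bound K) S \<sigma> u \<beta> (s + t) \<longleftrightarrow>
        \<sigma> u - s \<le> bound L \<and> \<sigma> u - s < t \<and> f (u, \<beta>, t - (\<sigma> u - s))" if u: "u \<in> S" for u
    proof -
      have "s + t - \<sigma> u = t - (\<sigma> u - s)" using s_le[OF u] by simp
      moreover have "t - (\<sigma> u - s) \<le> bound K"
        using t(2) bound_mono[OF \<open>L \<le> K\<close>] by simp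
      ultimately show ?thesis
        unfolding transmits_def using u s_le[OF u] t(2) by auto
    qed
    then show ?thesis unfolding D_def by auto
  qed
  then have "woken_at b ?T (bound K) S \<sigma> (s + t)"
    unfolding woken_at_def using one \<beta> by (intro bexI[of _ \<beta>]) simp_all
  then have "wakes_within b ?T (bound K) S \<sigma> (real (bound L))"
    unfolding wakes_within_def s_def[symmetric] using t(2) by (intro exI[of _ "s + t"]) simp
  then show ?thesis using \<open>2 ^ L \<le> 2 * k\<close> by blast
qed

end

section \<open>Choice of the constants and conclusion\<close>

lemma wakes_within_mono: "wakes_within b T len S \<sigma> m \<Longrightarrow> m \<le> m' \<Longrightarrow> wakes_within b T len S \<sigma> m'"
  unfolding wakes_within_def by (meson order_trans)

lemma lg_ge_1: "1 \<le> lg n"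
  by (simp add: lg_def)

lemma log_le_lg: "log 2 (real n) \<le> lg n"
  by (simp add: lg_def)

lemma lg_le: "1 \<le> n \<Longrightarrow> lg n \<le> real n"
proof -
  assume n: "1 \<le> n"
  have "real n \<le> 2 ^ n" using less_exp[of n] by (metis less_imp_le of_nat_le_iff of_nat_numeral of_nat_power)
  then have "log 2 (real n) \<le> real n" using n by (simp add: log_le_iff powr_realpow)
  then show ?thesis using n by (simp add: lg_def)
qed

theorem theorem3:
  shows "\<exists>c1 c2 :: real. c1 > 0 \<and> c2 > 0 \<and>
    (\<forall>n b :: nat. 1 \<le> n \<longrightarrow> 1 \<le> b \<longrightarrow>
      (\<exists>(T :: tarray) (len :: nat).
         real len \<le> c1 * real n * lg n * lg n powr (1 / real b) \<and>
         (\<forall>k :: nat. \<forall>S :: nat set. \<forall>sigma :: nat \<Rightarrow> nat.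
            k \<le> n \<longrightarrow> S \<subseteq> {1..n} \<longrightarrow> S \<noteq> {} \<longrightarrow> card S \<le> k \<longrightarrow>
            wakes_within b T len S sigma (c2 * real k * lg n * lg k powr (1 / real b)))))"
proof -
  \<comment> \<open>The power of 4 cancels \<open>(1/4) ^ 10\<close>, leaving the failure base
    \<open>exp (- 40 g)\<close>. Of the 40, 5 give the fifth power of 1/n and 35 absorb
    \<open>C\<close> itself.\<close>
  define C :: nat where "C = 40 * 4 ^ 10"
  \<comment> \<open>The factor 16 collects 2 from rounding \<open>lg n\<close> up to
    \<open>g\<close>, 2 from \<open>2 ^ L \<le> 2 * k\<close>, and 4 from the width.\<close>
  define c where "c = 16 * real C"
  have C: "1 \<le> C" by (simp add: C_def)
  have main: "\<exists>(T :: tarray) (len :: nat).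
      real len \<le> c * real n * lg n * lg n powr (1 / real b) \<and>
      (\<forall>k S sigma. k \<le> n \<longrightarrow> S \<subseteq> {1..n} \<longrightarrow> S \<noteq> {} \<longrightarrow> card S \<le> k \<longrightarrow>
        wakes_within b T len S sigma (c * real k * lg n * lg k powr (1 / real b)))"
    if n: "1 \<le> n" and b: "1 \<le> b" for n b :: nat
  proof -
    define g where "g = nat \<lceil>lg n\<rceil>"
    have g: "1 \<le> g" "lg n \<le> real g" "real g \<le> 2 * lg n" "g \<le> n"
      using lg_ge_1[of n] lg_le[OF n] unfolding g_def by linarith+
    define M where "M = C * g"
    interpret random_array n b M
      by unfold_locales (use b C g in \<open>auto simp: M_def\<close>)
    obtain d where d: "2 ^ d \<le> n" "n < 2 ^ (d + 1)"
      using ex_power_ivl1[of 2 n] n by auto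
    define K where "K = d + 1"
    have K: "n < 2 ^ K" "2 ^ K \<le> 2 * n" "K \<le> n"
      using d order_trans[OF Suc_leI[OF less_exp] d(1)] by (simp_all add: K_def)

    \<comment> \<open>Serves twice: for the waking time, and with \<open>L = K\<close> and
      \<open>k = n\<close> for the array length.\<close>
    have bound_le: "real (bound L) \<le> c * real k * lg n * lg k powr (1 / real b)"
      if L: "2 ^ L \<le> 2 * k" for L k
    proof -
      have k: "1 \<le> k" using L by (cases k) auto
      have L': "(2::real) ^ L \<le> 2 * real k"
        using L by (metis of_nat_le_iff of_nat_mult of_nat_numeral of_nat_power)
      have "real L = log 2 (2 ^ L)" by (simp add: log_nat_power)
      also have "\<dots> \<le> log 2 (2 * real k)" using L' k by (intro log_mono) auto
      also have "\<dots> = 1 + log 2 (real k)" using k by (simp add: log_mult)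
      also have "\<dots> \<le> 2 * lg k" using lg_ge_1[of k] log_le_lg[of k] by linarith
      finally have "real L powr (1 / real b) \<le> (2 * lg k) powr (1 / real b)"
        by (intro powr_mono2) auto
      also have "\<dots> = 2 powr (1 / real b) * lg k powr (1 / real b)"
        using lg_ge_1[of k] by (intro powr_mult) 
      also have "\<dots> \<le> 2 powr 1 * lg k powr (1 / real b)"
        using b by (intro mult_right_mono powr_mono) auto
      finally have "real (width L) \<le> 4 * lg k powr (1 / real b)"
        using width_le[of L] by simp
      then have "real M * 2 ^ L * real (width L) \<le>
          (real C * (2 * lg n)) * (2 * real k) * (4 * lg k powr (1 / real b))"
        unfolding M_def of_nat_mult using g(3) L' lg_ge_1[of n] by (intro mult_mono) auto
      then show ?thesis by (simp add: bound_def c_def ac_simps)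
    qed

    \<comment> \<open>There are at most 5 C times the fourth power of n choices per list entry;
      against the fifth power of 1/n this leaves 1/n, which pays for the at most n levels.\<close>
    define q where "q = 5 * real C / (2 ^ 35 * real n)"
    have "\<exists>f. \<forall>L D off. 1 \<le> L \<longrightarrow> L \<le> K \<longrightarrow> D \<subseteq> {1..n} \<longrightarrow> D \<noteq> {} \<longrightarrow> card D \<le> 2 ^ L \<longrightarrow>
      off ` D \<subseteq> {..bound L} \<longrightarrow> 2 ^ (L - 1) \<le> card {u\<in>D. off u \<le> bound (L - 1)} \<longrightarrow>
      f \<notin> asleep L D off"
    proof (rule exists_waking_array[of K "bound K" q])
      show "bound K \<le> bound K" ..
      have "q \<le> 1 / real n * (5 * real C / 2 ^ 35)" by (simp add: q_def)
      also have "\<dots> \<le> 1 / real n * (1/2)"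
        by (intro mult_left_mono) (simp_all add: C_def)
      finally have q: "q \<le> 1 / (2 * real n)" by simp
      then show "q \<le> 1" using n by (auto intro: order_trans)
      have "real K * q \<le> real n * (1 / (2 * real n))"
        using K(3) q by (intro mult_mono) (auto simp: q_def)
      also have "\<dots> < 1" using n by simp
      finally show "real K * q < 1" .
      fix L assume L: "L \<le> K"
      have "2 ^ L \<le> (2::nat) ^ K" using L by (intro power_increasing) auto
      then have L2: "2 ^ L \<le> 2 * n" using K(2) by (rule order_trans)
      have "width L \<le> 2 * n" using width_le_self[of L] L K(3) by simp
      then have "bound L \<le> (C * n) * (2 * n) * (2 * n)"
        unfolding bound_def unfolding M_def using L2 g(4) by (intro mult_le_mono) auto
      also have "\<dots> = 4 * (C * n ^ 3)" by (simp add: power3_eq_cube)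
      finally have "bound L \<le> 4 * (C * n ^ 3)" .
      moreover have "C * n ^ 3 \<noteq> 0" using C n by simp
      ultimately have "Suc (bound L) \<le> 5 * (C * n ^ 3)" by linarith
      then have "Suc (bound L) \<le> 5 * C * n ^ 3" by (simp only: mult.assoc)
      then have "n * Suc (bound L) \<le> n * (5 * C * n ^ 3)" by (intro mult_le_mono) auto
      then have 1: "real (n * Suc (bound L)) \<le> real (n * (5 * C * n ^ 3))"
        by (simp only: of_nat_le_iff)
      have e: "(1/4 :: real) ^ 10 * real M = real (40 * g)"
        by (simp add: M_def C_def power_one_over)
      have "exp (-1 :: real) \<le> 1/2"
        using exp_ge_add_one_self[of 1] by (simp add: exp_minus field_simps)
      then have "exp (- 1 :: real) ^ (40 * g) \<le> (1/2) ^ (40 * g)" by (intro power_mono) auto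
      then have "exp (- ((1/4) ^ 10 * real M)) \<le> (1/2) ^ (40 * g)"
        unfolding e by (simp add: exp_of_nat_mult[symmetric])
      also have "\<dots> = (1/2) ^ (35 * g) * ((1/2) ^ g) ^ 5"
        by (simp add: power_add[symmetric] power_mult[symmetric] mult.commute)
      also have "\<dots> \<le> (1/2) ^ 35 * (1 / real n) ^ 5"
      proof (intro mult_mono power_mono)
        show "(1/2 :: real) ^ (35 * g) \<le> (1/2) ^ 35"
          using g(1) by (intro power_decreasing) auto
        have "log 2 (real n) \<le> real g" using g(2) log_le_lg[of n] by linarith
        then have "real n \<le> 2 ^ g" using n by (simp add: log_le_iff powr_realpow)
        then show "(1/2 :: real) ^ g \<le> 1 / real n"
          using n by (simp add: power_one_over frac_le)
      qed auto
      finally have 2: "exp (- ((1/4) ^ 10 * real M)) \<le> (1/2) ^ 35 * (1 / real n) ^ 5" .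
      have "real (n * Suc (bound L)) * exp (- ((1/4) ^ 10 * real M)) \<le>
          real (n * (5 * C * n ^ 3)) * ((1/2) ^ 35 * (1 / real n) ^ 5)"
        using 1 2 by (intro mult_mono) auto
      also have "\<dots> = q"
      proof -
        have "real n ^ 4 * (1 / real n) ^ 5 = 1 / real n"
          using n by (simp add: power_one_over field_simps eval_nat_numeral)
        moreover have "real (n * (5 * C * n ^ 3)) * ((1/2) ^ 35 * (1 / real n) ^ 5) =
            5 * real C * (1/2) ^ 35 * (real n ^ 4 * (1 / real n) ^ 5)"
          by (simp add: eval_nat_numeral)
        ultimately show ?thesis by (simp add: q_def power_one_over)
      qed
      finally show "real (n * Suc (bound L)) * exp (- ((1/4) ^ 10 * real M)) \<le> q" .
    qed
    then obtain f where f: "\<And>L D off. 1 \<le> L \<Longrightarrow> L \<le> K \<Longrightarrow> D \<subseteq> {1..n} \<Longrightarrow> D \<noteq> {} \<Longrightarrow> card D \<le> 2 ^ L \<Longrightarrow>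
      off ` D \<subseteq> {..bound L} \<Longrightarrow> 2 ^ (L - 1) \<le> card {u\<in>D. off u \<le> bound (L - 1)} \<Longrightarrow>
      f \<notin> asleep L D off"
      by blast
    have "wakes_within b (\<lambda>u \<beta> j. f (u, \<beta>, j)) (bound K) S sigma (c * real k * lg n * lg k powr (1 / real b))"
      if kS: "k \<le> n" "S \<subseteq> {1..n}" "S \<noteq> {}" "card S \<le> k" for k S sigma
    proof -
      obtain L where L: "2 ^ L \<le> 2 * k"
        and w: "wakes_within b (\<lambda>u \<beta> j. f (u, \<beta>, j)) (bound K) S sigma (real (bound L))"
        using wakes_within_bound[OF f K(1) kS] by blast
      show ?thesis by (rule wakes_within_mono[OF w bound_le[OF L]])
    qed
    then show ?thesis using bound_le[OF K(2)] by blast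
  qed
  have "c > 0" using C by (simp add: c_def)
  then show ?thesis using main by (intro exI[of _ c]) auto
qed

end
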